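(* Let $G=(V,E)$ be the agent dependency graph, a directed acyclic graph on a finite set $V=\{v_1,\ldots,v_n\}$ of agents. Under the contamination-reachability blocking rule (given in the context), evaluated in any topological order of $G$, an agent $v_j$ that passes its own behavioral test is $\mathtt{Blocked}$ if and only if $\mathcal{A}(v_j)$ contains a $\mathtt{Failed}$ agent. Equivalently, the set of $\mathtt{Blocked}$ agents is exactly the transitive descendant set $\mathcal{D}(v_f)$ of the failed agent(s) $v_f$.
   Context: An edge $(v_i,v_j)\in E$ means that agent $v_j$ consumes the output of $v_i$ or invokes $v_i$ as a tool. For $v_j\in V$ the ancestor set is $\mathcal{A}(v_j)=\{v_i\in V:\text{there is a directed path from } v_i \text{ to } v_j\}$, and for $v_i\in V$ the (transitive) descendant set is $\mathcal{D}(v_i)=\{v_j\in V:\text{there is a directed path from } v_i\text{ to } v_j\}$; directed paths have at least one edge, so no agent is its own ancestor or descendant. Status assignment: each agent either passes or fails its own behavioral test. An agent that fails its own test has status $\mathtt{Failed}$. Agents are processed in a topological order of $G$ (every ancestor of an agent comes before that agent). The blocking rule is: an agent $v_j$ that does not itself fail has $$\mathrm{Status}_j=\mathtt{Blocked}\iff \exists\, v_i\in\mathcal{A}(v_j)\ \text{with}\ \mathrm{Status}_i\in\{\mathtt{Failed},\mathtt{Blocked}\},$$ and otherwise it has $\mathrm{Status}_j=\mathtt{Validated}$.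
   Formalization: The set of Blocked agents is shown to be the union of the D(v_f) over Failed v_f minus the Failed agents; literal equality is claimed only when no Failed agent descends from a Failed one, since it is false otherwise (edge a→b, both fail: none Blocked, but D(a)={b}). *)

theory Defs
  imports Main
begin

text \<open>
  A graph is given by its vertex set \<open>V\<close> and its edge relation \<open>E \<subseteq> V \<times> V\<close>.  Directed paths
  have at least one edge, hence the transitive closure \<open>E\<^sup>+\<close> rather than \<open>E\<^sup>*\<close>.
\<close>

definition ancestors :: "'a set \<Rightarrow> ('a \<times> 'a) set \<Rightarrow> 'a \<Rightarrow> 'a set" where
  "ancestors V E v = {u \<in> V. (u, v) \<in> E\<^sup>+}"

definition descendants :: "'a set \<Rightarrow> ('a \<times> 'a) set \<Rightarrow> 'a \<Rightarrow> 'a set" where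
  "descendants V E u = {v \<in> V. (u, v) \<in> E\<^sup>+}"

definition topological_order :: "'a set \<Rightarrow> ('a \<times> 'a) set \<Rightarrow> 'a list \<Rightarrow> bool" where
  "topological_order V E vs \<longleftrightarrow>
     distinct vs \<and> set vs = V \<and>
     (\<forall>i < length vs. \<forall>j < length vs. vs ! i \<in> ancestors V E (vs ! j) \<longrightarrow> i < j)"

datatype status = Failed | Blocked | Validated

text \<open>
  The status of \<open>v\<close> according to the blocking rule, where \<open>st\<close> holds the statuses assigned so far
  (\<open>None\<close> for an agent not yet processed) and \<open>fails v\<close> says that \<open>v\<close> fails its own test.
\<close>

definition assign_status ::
    "'a set \<Rightarrow> ('a \<times> 'a) set \<Rightarrow> ('a \<Rightarrow> bool) \<Rightarrow> ('a \<rightharpoonup> status) \<Rightarrow> 'a \<Rightarrow> status" where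
  "assign_status V E fails st v =
     (if fails v then Failed
      else if \<exists>u \<in> ancestors V E v. st u \<in> {Some Failed, Some Blocked} then Blocked
      else Validated)"

definition evaluate ::
    "'a set \<Rightarrow> ('a \<times> 'a) set \<Rightarrow> ('a \<Rightarrow> bool) \<Rightarrow> 'a list \<Rightarrow> ('a \<rightharpoonup> status)" where
  "evaluate V E fails vs = fold (\<lambda>v st. st(v \<mapsto> assign_status V E fails st v)) vs Map.empty"

definition agents_with :: "'a set \<Rightarrow> ('a \<rightharpoonup> status) \<Rightarrow> status \<Rightarrow> 'a set" where
  "agents_with V st s = {v \<in> V. st v = Some s}"

text \<open>
  Along a topological order every ancestor is processed first, so the final statuses satisfy the
  blocking rule with respect to themselves.
\<close>

lemma evaluate_append:
  "evaluate V E fails (xs @ [v]) =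
     (evaluate V E fails xs)(v \<mapsto> assign_status V E fails (evaluate V E fails xs) v)"
  by (simp add: evaluate_def)

lemma evaluate_notin: "v \<notin> set ys \<Longrightarrow> evaluate V E fails (xs @ ys) v = evaluate V E fails xs v"
  by (induction ys rule: rev_induct) (auto simp: evaluate_append simp flip: append_assoc)

lemma evaluate_blocking_rule:
  assumes "topological_order V E vs" and "v \<in> V"
  shows "evaluate V E fails vs v = Some (assign_status V E fails (evaluate V E fails vs) v)"
proof -
  have d: "distinct vs" and sv: "set vs = V"
    using assms(1) by (auto simp: topological_order_def)
  obtain xs ys where vs: "vs = xs @ v # ys"
    using assms(2) sv by (metis split_list)
  have eq: "evaluate V E fails vs u = evaluate V E fails xs u" if u: "u \<in> ancestors V E v" for u
  proof -
    have "u \<in> set vs" using u sv by (auto simp: ancestors_def)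
    then obtain i where i: "i < length vs" "vs ! i = u" by (auto simp: in_set_conv_nth)
    have "i < length xs"
      using assms(1) i u vs unfolding topological_order_def
      by (metis add_less_cancel_left add.right_neutral length_append length_Cons nth_append_length
          zero_less_Suc)
    then have "u \<in> set xs" using i vs by (auto simp: nth_append)
    then have "u \<notin> set (v # ys)" using d vs by auto
    then show ?thesis using evaluate_notin vs by metis
  qed
  have "evaluate V E fails vs v = evaluate V E fails (xs @ [v]) v"
    using evaluate_notin[of v ys V E fails "xs @ [v]"] d vs by simp
  then show ?thesis
    using eq by (simp add: evaluate_append assign_status_def cong: bex_cong)
qed

end

theory Submission
  imports Defs
begin

text \<open>
  A blocked agent has a blocked or failed ancestor.  Since the graph is finite and acyclic, the
  ancestor relation is well-founded, so following blocked ancestors upwards must end at a failed one.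
\<close>

lemma evaluate_eq_Failed_iff:
  assumes "topological_order V E vs" and "v \<in> V"
  shows "evaluate V E fails vs v = Some Failed \<longleftrightarrow> fails v"
  using evaluate_blocking_rule[OF assms, of fails] by (simp add: assign_status_def)

text \<open>The final statuses are a fixed point of the blocking rule by
  \<open>evaluate_blocking_rule\<close>, so the rule can be unfolded at any agent without looking at
  intermediate states of the evaluation.\<close>

lemma evaluate_eq_Blocked_iff:
  assumes "topological_order V E vs" and "v \<in> V"
  shows "evaluate V E fails vs v = Some Blocked \<longleftrightarrow>
    \<not> fails v \<and> (\<exists>u \<in> ancestors V E v. evaluate V E fails vs u \<in> {Some Failed, Some Blocked})"
  using evaluate_blocking_rule[OF assms, of fails] by (simp add: assign_status_def)

lemma blocked_has_failed_ancestor: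
  assumes "finite E" and "acyclic E" and "topological_order V E vs"
    and "v \<in> V" and "evaluate V E fails vs v = Some Blocked"
  shows "\<exists>u \<in> ancestors V E v. evaluate V E fails vs u = Some Failed"
proof -
  \<comment> \<open>The induction runs along \<open>E\<^sup>+\<close> and not \<open>E\<close>,
    because the blocking rule yields an arbitrary ancestor, possibly several edges away.\<close>
  have "wf (E\<^sup>+)"
    using assms(1,2) by (intro wf_trancl finite_acyclic_wf)
  then show ?thesis
    using assms(4,5)
  proof (induction v rule: wf_induct_rule)
    case (less v)
    then obtain u where u: "u \<in> ancestors V E v"
      and st: "evaluate V E fails vs u \<in> {Some Failed, Some Blocked}"
      using assms(3) by (auto simp: evaluate_eq_Blocked_iff)
    show ?case
    proof (cases "evaluate V E fails vs u = Some Failed")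
      case True
      with u show ?thesis by blast
    next
      case False
      \<comment> \<open>Here \<open>u\<close> is itself blocked, so the induction hypothesis
        supplies a failed ancestor of \<open>u\<close>, which by transitivity is also an ancestor of
        \<open>v\<close>.\<close>
      with less.IH[of u] u st obtain w where
        "w \<in> ancestors V E u" "evaluate V E fails vs w = Some Failed"
        by (auto simp: ancestors_def)
      with u show ?thesis by (auto simp: ancestors_def intro: trancl_trans)
    qed
  qed
qed

text \<open>This removes the recursion from the blocking rule: blocked ancestors trace back to
  failed ones, and conversely a failed ancestor triggers the rule directly.\<close>

lemma evaluate_eq_Blocked_iff_failed_ancestor:
  assumes "finite E" and "acyclic E" and "topological_order V E vs" and "v \<in> V"
  shows "evaluate V E fails vs v = Some Blocked \<longleftrightarrow>
    \<not> fails v \<and> (\<exists>u \<in> ancestors V E v. evaluate V E fails vs u = Some Failed)"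
  using blocked_has_failed_ancestor[OF assms] evaluate_eq_Blocked_iff[OF assms(3,4)] by blast

theorem proposition5p1:
  fixes V :: "'a set" and E :: "('a \<times> 'a) set" and fails :: "'a \<Rightarrow> bool" and vs :: "'a list"
    and st :: "'a \<rightharpoonup> status"
  assumes "finite V" and "E \<subseteq> V \<times> V" and "acyclic E"
    and "topological_order V E vs"
    and "st = evaluate V E fails vs"
  shows "(\<forall>v \<in> V. \<not> fails v \<longrightarrow>
            (st v = Some Blocked \<longleftrightarrow> (\<exists>u \<in> ancestors V E v. st u = Some Failed))) \<and>
         agents_with V st Blocked =
            (\<Union>f \<in> agents_with V st Failed. descendants V E f) - agents_with V st Failed \<and>
         ((\<forall>f \<in> agents_with V st Failed. \<forall>g \<in> agents_with V st Failed. g \<notin> descendants V E f)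
            \<longrightarrow> agents_with V st Blocked = (\<Union>f \<in> agents_with V st Failed. descendants V E f)) \<and>
         (\<forall>f. agents_with V st Failed = {f} \<longrightarrow> agents_with V st Blocked = descendants V E f)"
proof -
  let ?F = "agents_with V st Failed" and ?B = "agents_with V st Blocked"
  have "finite E"
    using assms(1,2) by (meson finite_SigmaI finite_subset)
  note blocked = evaluate_eq_Blocked_iff_failed_ancestor
    [OF this assms(3,4), where fails = fails, folded assms(5)]
  note failed = evaluate_eq_Failed_iff[OF assms(4), where fails = fails, folded assms(5)]
  \<comment> \<open>The failed agents are subtracted because an agent that fails its own test stays
    \<open>Failed\<close> even below another failed agent.\<close>
  have eq: "?B = (\<Union>f \<in> ?F. descendants V E f) - ?F"
    using blocked failed by (auto simp: agents_with_def descendants_def ancestors_def)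
  \<comment> \<open>If no failed agent descends from a failed agent, the subtraction removes
    nothing.\<close>
  have antichain: "?B = (\<Union>f \<in> ?F. descendants V E f)"
    if "\<forall>f \<in> ?F. \<forall>g \<in> ?F. g \<notin> descendants V E f"
    using eq that by blast
  have single: "?B = descendants V E f" if "?F = {f}" for f
  proof -
    \<comment> \<open>By acyclicity a single failed agent meets the antichain condition.\<close>
    have "f \<notin> descendants V E f"
      using assms(3) by (simp add: descendants_def acyclic_def)
    with antichain that show ?thesis by simp
  qed
  show ?thesis
    using blocked eq antichain single by blast
qed

end
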